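(* Suppose $(S,\to,\twoheadrightarrow,\hookrightarrow)$ is a two-acyclic factorization system and let $[(X_1,Y_1),(X_2,Y_2)]$ be an interval in $\operatorname{Pairs}(\to)$. Let $\to'$ be the restriction of $\to$ to $X_2\cap Y_1$ and let $(\twoheadrightarrow',\hookrightarrow')=\operatorname{Fact}(\to')$. Then $(X_2\cap Y_1,\to',\twoheadrightarrow',\hookrightarrow')$ is a two-acyclic factorization system. The map $(U,V)\mapsto(U\cap Y_1,V\cap X_2)$ is an isomorphism from $[(X_1,Y_1),(X_2,Y_2)]$ to $\operatorname{Pairs}(\to')$.
   Context: For a binary relation $\to$ on a set $S$ and $X\subseteq S$, put $X^\perp=\{y\in S: x\not\to y\ \forall x\in X\}$ and ${}^\perp X=\{y\in S: y\not\to x\ \forall x\in X\}$. A maximal orthogonal pair is a pair $(X,Y)$ of subsets of $S$ with $Y=X^\perp$ and $X={}^\perp Y$. $\operatorname{Pairs}(\to)$ is the complete lattice of maximal orthogonal pairs, partially ordered by containment of first components (equivalently reverse containment of second components). For a reflexive relation $\to$ on $S$, $\operatorname{Fact}(\to)=(\twoheadrightarrow,\hookrightarrow)$, where $x\twoheadrightarrow y$ iff for all $z\in S$, $y\to z$ implies $x\to z$, and $x\hookrightarrow y$ iff for all $z\in S$, $z\to x$ implies $z\to y$. For preorders $\twoheadrightarrow,\hookrightarrow$ on $S$, $\operatorname{Mult}(\twoheadrightarrow,\hookrightarrow)$ is the relation relating $x$ to $z$ iff there is $y\in S$ with $x\twoheadrightarrow y\hookrightarrow z$. A factorization system is a tuple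 $(S,\to,\twoheadrightarrow,\hookrightarrow)$ ($S$ possibly infinite) with $\to$ a reflexive relation on $S$, $\operatorname{Fact}(\to)=(\twoheadrightarrow,\hookrightarrow)$ and $\operatorname{Mult}(\twoheadrightarrow,\hookrightarrow)=\to$. It is two-acyclic if it satisfies the order condition ($x\twoheadrightarrow y\twoheadrightarrow x$ implies $x=y$, and $x\hookrightarrow y\hookrightarrow x$ implies $x=y$) and the brick condition ($x\twoheadrightarrow y\hookrightarrow x$ implies $x=y$). *)

theory Defs
  imports "HOL-Algebra.Complete_Lattice"
begin

text \<open>
  A relation \<open>\<rightarrow>\<close> on \<open>S\<close> is a set \<open>r \<subseteq> S \<times> S\<close>, with \<open>(x, y) \<in> r\<close> for \<open>x \<rightarrow> y\<close>.
  The ground set \<open>S\<close> is an explicit argument because it is not determined by \<open>r\<close> and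
  varies within a single statement.
\<close>

definition perp_right :: "'a set \<Rightarrow> 'a rel \<Rightarrow> 'a set \<Rightarrow> 'a set" where
  "perp_right S r X = {y \<in> S. \<forall>x \<in> X. (x, y) \<notin> r}"

definition perp_left :: "'a set \<Rightarrow> 'a rel \<Rightarrow> 'a set \<Rightarrow> 'a set" where
  "perp_left S r X = {y \<in> S. \<forall>x \<in> X. (y, x) \<notin> r}"

definition max_orth_pair :: "'a set \<Rightarrow> 'a rel \<Rightarrow> 'a set \<times> 'a set \<Rightarrow> bool" where
  "max_orth_pair S r = (\<lambda>(X, Y). X \<subseteq> S \<and> Y \<subseteq> S \<and>
     Y = perp_right S r X \<and> X = perp_left S r Y)"

definition Pairs :: "'a set \<Rightarrow> 'a rel \<Rightarrow> ('a set \<times> 'a set) gorder" where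
  "Pairs S r = \<lparr>carrier = {P. max_orth_pair S r P}, eq = (=), le = (\<lambda>P Q. fst P \<subseteq> fst Q)\<rparr>"

definition Fact :: "'a set \<Rightarrow> 'a rel \<Rightarrow> 'a rel \<times> 'a rel" where
  "Fact S r =
     ({(x, y). x \<in> S \<and> y \<in> S \<and> (\<forall>z \<in> S. (y, z) \<in> r \<longrightarrow> (x, z) \<in> r)},
      {(x, y). x \<in> S \<and> y \<in> S \<and> (\<forall>z \<in> S. (z, x) \<in> r \<longrightarrow> (z, y) \<in> r)})"

definition Mult :: "'a rel \<Rightarrow> 'a rel \<Rightarrow> 'a rel" where
  "Mult e m = e O m"

definition factorization_system :: "'a set \<Rightarrow> 'a rel \<Rightarrow> 'a rel \<Rightarrow> 'a rel \<Rightarrow> bool" where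
  "factorization_system S r e m \<longleftrightarrow>
     r \<subseteq> S \<times> S \<and> refl_on S r \<and> Fact S r = (e, m) \<and> Mult e m = r"

definition order_condition :: "'a rel \<Rightarrow> 'a rel \<Rightarrow> bool" where
  "order_condition e m \<longleftrightarrow> antisym e \<and> antisym m"

definition brick_condition :: "'a rel \<Rightarrow> 'a rel \<Rightarrow> bool" where
  "brick_condition e m \<longleftrightarrow> (\<forall>x y. (x, y) \<in> e \<and> (y, x) \<in> m \<longrightarrow> x = y)"

definition two_acyclic_factorization_system ::
    "'a set \<Rightarrow> 'a rel \<Rightarrow> 'a rel \<Rightarrow> 'a rel \<Rightarrow> bool" where
  "two_acyclic_factorization_system S r e m \<longleftrightarrow>
     factorization_system S r e m \<and> order_condition e m \<and> brick_condition e m"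

text \<open>For (complete) lattices, an order isomorphism is the same as a lattice isomorphism.\<close>

definition order_iso :: "('a, 'c) gorder_scheme \<Rightarrow> ('b, 'd) gorder_scheme \<Rightarrow> ('a \<Rightarrow> 'b) \<Rightarrow> bool"
  where "order_iso L M f \<longleftrightarrow> bij_betw f (carrier L) (carrier M) \<and> order_emb L M f"

lemma mem_Pairs_iff:
  "(X, Y) \<in> carrier (Pairs S r) \<longleftrightarrow>
     X \<subseteq> S \<and> Y \<subseteq> S \<and> Y = perp_right S r X \<and> X = perp_left S r Y"
  by (simp add: Pairs_def max_orth_pair_def)

lemma le_Pairs_iff: "P \<sqsubseteq>\<^bsub>Pairs S r\<^esub> Q \<longleftrightarrow> fst P \<subseteq> fst Q"
  by (simp add: Pairs_def)

lemma perp_antimono: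
  assumes "A \<subseteq> B"
  shows "perp_right S r B \<subseteq> perp_right S r A" "perp_left S r B \<subseteq> perp_left S r A"
  using assms by (auto simp: perp_right_def perp_left_def)

lemma le_Pairs_iff_snd:
  assumes "P \<in> carrier (Pairs S r)" "Q \<in> carrier (Pairs S r)"
  shows "P \<sqsubseteq>\<^bsub>Pairs S r\<^esub> Q \<longleftrightarrow> snd Q \<subseteq> snd P"
proof -
  have P: "snd P = perp_right S r (fst P)" "fst P = perp_left S r (snd P)"
    and Q: "snd Q = perp_right S r (fst Q)" "fst Q = perp_left S r (snd Q)"
    using assms mem_Pairs_iff[of "fst P" "snd P" S r] mem_Pairs_iff[of "fst Q" "snd Q" S r]
    unfolding prod.collapse by blast+
  show ?thesis unfolding le_Pairs_iff using P Q perp_antimono by metis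
qed

lemma partial_order_Pairs: "partial_order (Pairs S r)"
  by unfold_locales (auto simp: Pairs_def max_orth_pair_def)

lemma complete_lattice_Pairs: "complete_lattice (Pairs S r)"
proof -
  interpret partial_order "Pairs S r" by (rule partial_order_Pairs)
  show ?thesis
  proof (rule complete_latticeI)
    fix A assume A: "A \<subseteq> carrier (Pairs S r)"
    have eq: "fst P = perp_left S r (snd P)" "snd P = perp_right S r (fst P)" "snd P \<subseteq> S" "fst P \<subseteq> S"
      if "P \<in> carrier (Pairs S r)" for P
      using that mem_Pairs_iff[of "fst P" "snd P" S r] unfolding prod.collapse by blast+
    have AC: "P \<in> carrier (Pairs S r)" if "P \<in> A" for P
      using A that by blast
    {
      define Y where "Y = {y \<in> S. \<forall>P \<in> A. y \<in> snd P}"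
      define X where "X = perp_left S r Y"
      have X: "fst P \<subseteq> X" if "P \<in> A" for P
      proof -
        have "Y \<subseteq> snd P" using that by (auto simp: Y_def)
        from perp_antimono(2)[OF this, of S r] show ?thesis
          unfolding X_def using eq(1)[OF AC[OF that]] by metis
      qed
      have "perp_right S r X \<subseteq> snd P" if "P \<in> A" for P
        using perp_antimono(1)[OF X[OF that], of S r] eq(2)[OF AC[OF that]] by metis
      then have "perp_right S r X \<subseteq> Y"
        by (auto simp: Y_def perp_right_def)
      moreover have "Y \<subseteq> perp_right S r X"
        by (auto simp: X_def Y_def perp_left_def perp_right_def)
      moreover have "X \<subseteq> S" "Y \<subseteq> S"
        by (auto simp: X_def Y_def perp_left_def)
      ultimately have mem: "(X, Y) \<in> carrier (Pairs S r)"
        unfolding mem_Pairs_iff using X_def by blast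
      have "least (Pairs S r) (X, Y) (Upper (Pairs S r) A)"
      proof (rule least_UpperI[OF _ _ A mem])
        show "P \<sqsubseteq>\<^bsub>Pairs S r\<^esub> (X, Y)" if "P \<in> A" for P
          using X[OF that] by (simp add: le_Pairs_iff)
      next
        fix Q assume Q: "Q \<in> Upper (Pairs S r) A"
        then have QC: "Q \<in> carrier (Pairs S r)" by (simp add: Upper_def)
        have "snd Q \<subseteq> snd P" if "P \<in> A" for P
        proof -
          note PC = AC[OF that]
          have "P \<sqsubseteq>\<^bsub>Pairs S r\<^esub> Q" using Q PC that unfolding Upper_def by blast
          then show ?thesis using le_Pairs_iff_snd[OF PC QC] by simp
        qed
        then have "snd Q \<subseteq> Y" using eq(3)[OF QC] unfolding Y_def by blast
        then show "(X, Y) \<sqsubseteq>\<^bsub>Pairs S r\<^esub> Q" using le_Pairs_iff_snd[OF mem QC] by simp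
      qed
      then show "\<exists>s. least (Pairs S r) s (Upper (Pairs S r) A)" ..
    }
    {
      define X where "X = {x \<in> S. \<forall>P \<in> A. x \<in> fst P}"
      define Y where "Y = perp_right S r X"
      have XP: "X \<subseteq> fst P" if "P \<in> A" for P
        using that by (auto simp: X_def)
      have PY: "snd P \<subseteq> Y" if "P \<in> A" for P
        unfolding Y_def using perp_antimono(1)[OF XP[OF that], of S r] eq(2)[OF AC[OF that]] by metis
      have "perp_left S r Y \<subseteq> fst P" if "P \<in> A" for P
        using perp_antimono(2)[OF PY[OF that], of S r] eq(1)[OF AC[OF that]] by metis
      then have "perp_left S r Y \<subseteq> X"
        by (auto simp: X_def perp_left_def)
      moreover have "X \<subseteq> perp_left S r Y"
        by (auto simp: X_def Y_def perp_left_def perp_right_def)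
      moreover have "X \<subseteq> S" "Y \<subseteq> S"
        by (auto simp: X_def Y_def perp_right_def)
      ultimately have mem: "(X, Y) \<in> carrier (Pairs S r)"
        unfolding mem_Pairs_iff using Y_def by blast
      have "greatest (Pairs S r) (X, Y) (Lower (Pairs S r) A)"
      proof (rule greatest_LowerI[OF _ _ A mem])
        show "(X, Y) \<sqsubseteq>\<^bsub>Pairs S r\<^esub> P" if "P \<in> A" for P
          using XP[OF that] by (simp add: le_Pairs_iff)
      next
        fix Q assume Q: "Q \<in> Lower (Pairs S r) A"
        then have QC: "Q \<in> carrier (Pairs S r)" by (simp add: Lower_def)
        have "fst Q \<subseteq> fst P" if "P \<in> A" for P
        proof -
          have "Q \<sqsubseteq>\<^bsub>Pairs S r\<^esub> P" using Q AC[OF that] that unfolding Lower_def by blast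
          then show ?thesis by (simp add: le_Pairs_iff)
        qed
        then have "fst Q \<subseteq> X" using eq(4)[OF QC] unfolding X_def by blast
        then show "Q \<sqsubseteq>\<^bsub>Pairs S r\<^esub> (X, Y)" by (simp add: le_Pairs_iff)
      qed
      then show "\<exists>i. greatest (Pairs S r) i (Lower (Pairs S r) A)" ..
    }
  qed
qed

end

theory Submission
  imports Defs
begin

text \<open>
  Write \<open>I = X2 \<inter> Y1\<close>. First components of maximal orthogonal pairs are closed under
  \<open>\<twoheadrightarrow>\<close>-images and second components under \<open>\<hookrightarrow>\<close>-subobjects, so a factorization
  \<open>x \<twoheadrightarrow> w \<hookrightarrow> y\<close> of an arrow \<open>x \<rightarrow> y\<close> with \<open>x \<in> X2\<close> and \<open>y \<in> Y1\<close> has \<open>w \<in> I\<close>. Thus arrows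
  in \<open>I\<close> factor inside \<open>I\<close>, and two-acyclicity passes to \<open>I\<close> by comparing such factorizations.
  Moreover \<open>V = Y1 \<inter> (U \<inter> Y1)\<^sup>\<bottom>\<close> for every \<open>(U, V)\<close> in the interval, so the restriction map
  is an order embedding; a preimage of \<open>(A, B)\<close> has second component \<open>Y1 \<inter> A\<^sup>\<bottom>\<close>.
\<close>

section \<open>Factorization preorders and orthogonal pairs\<close>

lemma mem_Fact_iff:
  assumes "(e, m) = Fact S r"
  shows "(x, y) \<in> e \<longleftrightarrow> x \<in> S \<and> y \<in> S \<and> (\<forall>z\<in>S. (y, z) \<in> r \<longrightarrow> (x, z) \<in> r)"
    and "(x, y) \<in> m \<longleftrightarrow> x \<in> S \<and> y \<in> S \<and> (\<forall>z\<in>S. (z, x) \<in> r \<longrightarrow> (z, y) \<in> r)"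
  using assms by (simp_all add: Fact_def)

text \<open>An arrow from \<open>y\<close> to some \<open>z\<close> in \<open>Y\<close> would, by
  the definition of \<open>e\<close>, give an arrow from \<open>x\<close> to \<open>z\<close>,
  against orthogonality; dually for \<open>m\<close>.\<close>

lemma perp_closed:
  assumes "(e, m) = Fact S r" "(X, Y) \<in> carrier (Pairs S r)"
  shows "\<lbrakk>x \<in> X; (x, y) \<in> e\<rbrakk> \<Longrightarrow> y \<in> X"
    and "\<lbrakk>y \<in> Y; (x, y) \<in> m\<rbrakk> \<Longrightarrow> x \<in> Y"
proof -
  have XY: "X \<subseteq> S" "Y \<subseteq> S" "Y = perp_right S r X" "X = perp_left S r Y"
    using assms(2) unfolding mem_Pairs_iff by blast+
  show "y \<in> X" if "x \<in> X" "(x, y) \<in> e"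
  proof -
    have "y \<in> S" "\<forall>z\<in>Y. (y, z) \<notin> r"
      using that XY(1,2) XY(3) mem_Fact_iff(1)[OF assms(1), of x y]
      by (auto simp: perp_right_def)
    then show ?thesis by (subst XY(4)) (auto simp: perp_left_def)
  qed
  show "x \<in> Y" if "y \<in> Y" "(x, y) \<in> m"
  proof -
    have "x \<in> S" "\<forall>z\<in>X. (z, x) \<notin> r"
      using that XY(1,2) XY(4) mem_Fact_iff(2)[OF assms(1), of x y]
      by (auto simp: perp_left_def)
    then show ?thesis by (subst XY(3)) (auto simp: perp_right_def)
  qed
qed

section \<open>Two-acyclic systems and their restrictions\<close>

locale two_acyclic =
  fixes S :: "'a set" and r e m :: "'a rel"
  assumes fs: "two_acyclic_factorization_system S r e m"
begin

lemma fact: "(e, m) = Fact S r"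
  using fs by (simp add: two_acyclic_factorization_system_def factorization_system_def)

lemma r_refl: "x \<in> S \<Longrightarrow> (x, x) \<in> r"
  using fs by (auto simp: two_acyclic_factorization_system_def factorization_system_def
      refl_on_def)

lemma r_factor:
  assumes "(x, y) \<in> r"
  obtains w where "(x, w) \<in> e" "(w, y) \<in> m"
  using fs assms
  by (auto simp: two_acyclic_factorization_system_def factorization_system_def Mult_def)

lemma e_into_r: "(x, y) \<in> e \<Longrightarrow> (x, y) \<in> r"
  and m_into_r: "(x, y) \<in> m \<Longrightarrow> (x, y) \<in> r"
  using mem_Fact_iff[OF fact] r_refl by blast+

lemma e_trans: "\<lbrakk>(x, y) \<in> e; (y, z) \<in> e\<rbrakk> \<Longrightarrow> (x, z) \<in> e"
  and m_trans: "\<lbrakk>(x, y) \<in> m; (y, z) \<in> m\<rbrakk> \<Longrightarrow> (x, z) \<in> m"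
  using mem_Fact_iff[OF fact] by auto

lemma e_antisym: "\<lbrakk>(x, y) \<in> e; (y, x) \<in> e\<rbrakk> \<Longrightarrow> x = y"
  and m_antisym: "\<lbrakk>(x, y) \<in> m; (y, x) \<in> m\<rbrakk> \<Longrightarrow> x = y"
  and brick: "\<lbrakk>(x, y) \<in> e; (y, x) \<in> m\<rbrakk> \<Longrightarrow> x = y"
  using fs by (auto simp: two_acyclic_factorization_system_def order_condition_def
      brick_condition_def dest: antisymD)

text \<open>
  If \<open>w \<hookrightarrow> y \<twoheadrightarrow> v \<hookrightarrow> w\<close>, then \<open>v \<hookrightarrow> y\<close>, so \<open>v = y\<close> by the brick condition; dually for \<open>\<twoheadrightarrow>\<close>.
\<close>

lemma m_back: "\<lbrakk>(w, y) \<in> m; (y, w) \<in> r\<rbrakk> \<Longrightarrow> w = y"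
  by (erule r_factor) (use m_trans m_antisym brick in blast)

lemma e_back: "\<lbrakk>(x, w) \<in> e; (w, x) \<in> r\<rbrakk> \<Longrightarrow> x = w"
  by (erule r_factor) (use e_trans e_antisym brick in blast)

text \<open>Passing to \<open>I\<close> shrinks the range of the quantifiers in \<open>Fact\<close>,
  so \<open>e'\<close> and \<open>m'\<close> contain the restrictions of \<open>e\<close> and
  \<open>m\<close> but may be larger. Old factorizations thus remain valid; for acyclicity it
  suffices to recover \<open>e\<close> or \<open>m\<close> on cycles.\<close>

lemma two_acyclic_Restr:
  assumes "I \<subseteq> S" and r': "r' = Restr r I" and F: "(e', m') = Fact I r'"
    and factor: "\<And>x w y. \<lbrakk>x \<in> I; y \<in> I; (x, w) \<in> e; (w, y) \<in> m\<rbrakk> \<Longrightarrow> w \<in> I"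
  shows "two_acyclic_factorization_system I r' e' m'"
proof -
  note E = mem_Fact_iff(1)[OF F] and M = mem_Fact_iff(2)[OF F]
  have refl: "(x, x) \<in> r'" if "x \<in> I" for x
    using that assms(1) r' r_refl by auto
  have e'_r: "(x, y) \<in> r" if "(x, y) \<in> e'" for x y
    using that E refl r' by blast
  have m'_r: "(x, y) \<in> r" if "(x, y) \<in> m'" for x y
    using that M refl r' by blast
  have e_e': "(x, y) \<in> e'" if "(x, y) \<in> e" "x \<in> I" "y \<in> I" for x y
    using that E mem_Fact_iff(1)[OF fact] assms(1) r' by blast
  have m_m': "(x, y) \<in> m'" if "(x, y) \<in> m" "x \<in> I" "y \<in> I" for x y
    using that M mem_Fact_iff(2)[OF fact] assms(1) r' by blast
  \<comment> \<open>Arrows compose with \<open>e'\<close> and \<open>m'\<close> only when the outer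
    element lies in \<open>I\<close>, hence the use of \<open>wI\<close> below.\<close>
  have e'_comp: "(x, z) \<in> r" if "(x, y) \<in> e'" "(y, z) \<in> r" "z \<in> I" for x y z
    using that E r' by blast
  have m'_comp: "(z, y) \<in> r" if "(x, y) \<in> m'" "(z, x) \<in> r" "z \<in> I" for x y z
    using that M r' by blast
  have "Mult e' m' = r'"
  proof
    show "Mult e' m' \<subseteq> r'"
      using E M refl unfolding Mult_def by blast
    show "r' \<subseteq> Mult e' m'"
    proof (rule subrelI)
      fix x y assume "(x, y) \<in> r'"
      then have xy: "(x, y) \<in> r" "x \<in> I" "y \<in> I" using r' by auto
      then obtain w where "(x, w) \<in> e" "(w, y) \<in> m" using r_factor by blast
      then show "(x, y) \<in> Mult e' m'"
        using factor e_e' m_m' xy unfolding Mult_def by blast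
    qed
  qed
  then have "factorization_system I r' e' m'"
    using refl r' F unfolding factorization_system_def refl_on_def by auto
  \<comment> \<open>The return arrow composes with one half of the factorization through
    \<open>w\<close> to an arrow against the other half, which then collapses by
    \<open>m_back\<close> or \<open>e_back\<close>. The disjunction serves both antisymmetry of
    \<open>e'\<close> and the brick condition.\<close>
  moreover have e'_e: "(x, y) \<in> e" if yx: "(x, y) \<in> e'" "(y, x) \<in> e' \<or> (y, x) \<in> m'" for x y
  proof -
    have I: "x \<in> I" "y \<in> I" using yx E by auto
    obtain w where w: "(x, w) \<in> e" "(w, y) \<in> m" using e'_r[OF yx(1)] r_factor by blast
    have wI: "w \<in> I" using factor I w by blast
    from yx(2) show ?thesis
    proof
      assume "(y, x) \<in> e'"
      then have "w = y" using e'_comp e_into_r[OF w(1)] wI m_back[OF w(2)] by blast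
      then show ?thesis using w by blast
    next
      assume yx': "(y, x) \<in> m'"
      then have "x = w" using m'_comp m_into_r[OF w(2)] wI e_back[OF w(1)] by blast
      then have "x = y" using m_back w(2) m'_r[OF yx'] by blast
      then show ?thesis using w \<open>x = w\<close> by blast
    qed
  qed
  moreover have m'_m: "(x, y) \<in> m" if yx: "(x, y) \<in> m'" "(y, x) \<in> m'" for x y
  proof -
    have I: "x \<in> I" "y \<in> I" using yx M by auto
    obtain w where w: "(x, w) \<in> e" "(w, y) \<in> m" using m'_r[OF yx(1)] r_factor by blast
    have wI: "w \<in> I" using factor I w by blast
    have "x = w" using m'_comp[OF yx(2) m_into_r[OF w(2)] wI] e_back[OF w(1)] by blast
    then show ?thesis using w by blast
  qed
  moreover have "x = y" if "(x, y) \<in> e'" "(y, x) \<in> m'" for x y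
    using e'_e that m'_r e_back by blast
  ultimately show ?thesis
    using e_antisym m_antisym
    by (simp add: two_acyclic_factorization_system_def order_condition_def brick_condition_def
        antisym_def)
qed

end

section \<open>Intervals of maximal orthogonal pairs\<close>

locale two_acyclic_interval = two_acyclic +
  fixes X1 Y1 X2 Y2 :: "'a set"
  assumes P1: "(X1, Y1) \<in> carrier (Pairs S r)"
    and P2: "(X2, Y2) \<in> carrier (Pairs S r)"
    and X1_le_X2: "X1 \<subseteq> X2"
begin

abbreviation "L \<equiv> \<lbrace>(X1, Y1)..(X2, Y2)\<rbrace>\<^bsub>Pairs S r\<^esub>"
abbreviation "I \<equiv> X2 \<inter> Y1"
abbreviation "r' \<equiv> Restr r I"

lemma mem_L_iff:
  "(U, V) \<in> L \<longleftrightarrow> (U, V) \<in> carrier (Pairs S r) \<and> X1 \<subseteq> U \<and> U \<subseteq> X2"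
  by (auto simp: at_least_at_most_def le_Pairs_iff)

lemma L_snd:
  assumes "(U, V) \<in> L"
  shows "V \<subseteq> Y1"
  using assms P1 le_Pairs_iff_snd[of "(X1, Y1)" S r "(U, V)"] unfolding mem_L_iff
  by (auto simp: le_Pairs_iff)

lemma interval_factor: "\<lbrakk>x \<in> X2; y \<in> Y1; (x, w) \<in> e; (w, y) \<in> m\<rbrakk> \<Longrightarrow> w \<in> I"
  using perp_closed[OF fact P1] perp_closed[OF fact P2] by blast

lemma I_subset: "I \<subseteq> S"
  using P1 unfolding mem_Pairs_iff by blast

text \<open>Any arrow from \<open>U\<close> into \<open>Y1\<close> factors through some
  \<open>w\<close> in \<open>U \<inter> Y1\<close> that still has an arrow to the target, so
  \<open>U \<inter> Y1\<close> excludes the same elements of \<open>Y1\<close> as \<open>U\<close>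
  does.\<close>

lemma snd_eq:
  assumes "(U, V) \<in> L"
  shows "V = Y1 \<inter> perp_right S r (U \<inter> Y1)"
proof
  have UV: "(U, V) \<in> carrier (Pairs S r)" using assms mem_L_iff by blast
  then have V: "V = perp_right S r U" unfolding mem_Pairs_iff by blast
  show "V \<subseteq> Y1 \<inter> perp_right S r (U \<inter> Y1)"
    using L_snd[OF assms] V by (auto simp: perp_right_def)
  show "Y1 \<inter> perp_right S r (U \<inter> Y1) \<subseteq> V"
  proof
    fix y assume y: "y \<in> Y1 \<inter> perp_right S r (U \<inter> Y1)"
    have "(u, y) \<notin> r" if "u \<in> U" for u
    proof
      assume "(u, y) \<in> r"
      then obtain w where w: "(u, w) \<in> e" "(w, y) \<in> m" by (rule r_factor)
      then have "w \<in> U \<inter> Y1"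
        using perp_closed(1)[OF fact UV that] perp_closed(2)[OF fact P1] y by blast
      then show False using m_into_r[OF w(2)] y by (auto simp: perp_right_def)
    qed
    then show "y \<in> V" using y by (subst V) (auto simp: perp_right_def)
  qed
qed

lemma fst_eq:
  assumes "(U, V) \<in> L"
  shows "U = X2 \<inter> perp_left S r (V \<inter> X2)"
proof
  have UV: "(U, V) \<in> carrier (Pairs S r)" "U \<subseteq> X2" using assms mem_L_iff by blast+
  then have U: "U = perp_left S r V" unfolding mem_Pairs_iff by blast
  show "U \<subseteq> X2 \<inter> perp_left S r (V \<inter> X2)"
    using UV(2) U by (auto simp: perp_left_def)
  show "X2 \<inter> perp_left S r (V \<inter> X2) \<subseteq> U"
  proof
    fix x assume x: "x \<in> X2 \<inter> perp_left S r (V \<inter> X2)"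
    have "(x, v) \<notin> r" if "v \<in> V" for v
    proof
      assume "(x, v) \<in> r"
      then obtain w where w: "(x, w) \<in> e" "(w, v) \<in> m" by (rule r_factor)
      then have "w \<in> V \<inter> X2"
        using perp_closed(2)[OF fact UV(1) that] perp_closed(1)[OF fact P2] x by blast
      then show False using e_into_r[OF w(1)] x by (auto simp: perp_left_def)
    qed
    then show "x \<in> U" using x by (subst U) (auto simp: perp_left_def)
  qed
qed

section \<open>The restriction map and its inverse\<close>

lemma perp_Restr:
  assumes "A \<subseteq> I"
  shows "perp_right I r' A = I \<inter> perp_right S r A" "perp_left I r' A = I \<inter> perp_left S r A"
  using assms I_subset by (auto simp: perp_right_def perp_left_def)

lemma restrict_mem:
  assumes "(U, V) \<in> L"
  shows "(U \<inter> Y1, V \<inter> X2) \<in> carrier (Pairs I r')"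
proof -
  have sub: "U \<inter> Y1 \<subseteq> I" "V \<inter> X2 \<subseteq> I"
    using assms L_snd[OF assms] unfolding mem_L_iff by auto
  have "V \<inter> X2 = perp_right I r' (U \<inter> Y1)"
    unfolding perp_Restr(1)[OF sub(1)] using snd_eq[OF assms] by auto
  moreover have "U \<inter> Y1 = perp_left I r' (V \<inter> X2)"
    unfolding perp_Restr(2)[OF sub(2)] using fst_eq[OF assms] by auto
  ultimately show ?thesis using sub unfolding mem_Pairs_iff by blast
qed

text \<open>By \<open>snd_eq\<close> the traces on \<open>Y1\<close> determine the second
  components, reversing inclusion; taking left perps reverses it again.\<close>

lemma restrict_le_iff:
  assumes "(U, V) \<in> L" "(U', V') \<in> L"
  shows "U \<inter> Y1 \<subseteq> U' \<inter> Y1 \<longleftrightarrow> U \<subseteq> U'"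
proof
  assume "U \<inter> Y1 \<subseteq> U' \<inter> Y1"
  then have "V' \<subseteq> V"
    using snd_eq[OF assms(1)] snd_eq[OF assms(2)]
      perp_antimono(1)[of "U \<inter> Y1" "U' \<inter> Y1" S r] by blast
  then have "perp_left S r V \<subseteq> perp_left S r V'" by (rule perp_antimono)
  then show "U \<subseteq> U'" using assms unfolding mem_L_iff mem_Pairs_iff by metis
qed blast

lemma restrict_surj:
  assumes "(A, B) \<in> carrier (Pairs I r')"
  obtains U V where "(U, V) \<in> L" "U \<inter> Y1 = A" "V \<inter> X2 = B"
proof -
  have AB: "A \<subseteq> I" "B \<subseteq> I" "B = perp_right I r' A" "A = perp_left I r' B"
    using assms unfolding mem_Pairs_iff by blast+
  have p1: "Y1 = perp_right S r X1" "X1 \<subseteq> S"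
    and p2: "Y2 = perp_right S r X2" "X2 = perp_left S r Y2" "X2 \<subseteq> S"
    using P1 P2 unfolding mem_Pairs_iff by blast+
  \<comment> \<open>\<open>(U, V)\<close> is the join of \<open>(X1, Y1)\<close> with the pair
    generated by \<open>A\<close>: \<open>U\<close> is the double perp of
    \<open>A \<union> X1\<close>.\<close>
  define V where "V = perp_right S r (A \<union> X1)"
  define U where "U = perp_left S r V"
  have sub: "A \<union> X1 \<subseteq> U" using AB(1) I_subset p1(2)
    by (auto simp: U_def V_def perp_left_def perp_right_def)
  have "V = perp_right S r U"
    using perp_antimono(1)[OF sub, of S r]
    by (auto simp: U_def V_def perp_left_def perp_right_def)
  moreover have "U \<subseteq> S" "V \<subseteq> S" by (auto simp: U_def V_def perp_left_def perp_right_def)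
  ultimately have UV: "(U, V) \<in> carrier (Pairs S r)" using U_def unfolding mem_Pairs_iff by blast
  have "A \<union> X1 \<subseteq> X2" using AB(1) X1_le_X2 by blast
  then have "Y2 \<subseteq> V" using perp_antimono(1)[of _ X2 S r] p2(1) V_def by metis
  then have "U \<subseteq> X2" using perp_antimono(2)[of Y2 V S r] p2(2) U_def by metis
  then have L: "(U, V) \<in> L" using UV sub unfolding mem_L_iff by blast
  have "V = Y1 \<inter> perp_right S r A" unfolding V_def p1(1) by (auto simp: perp_right_def)
  then have V: "V \<inter> X2 = B" using AB(3) unfolding perp_Restr(1)[OF AB(1)] by auto
  \<comment> \<open>The restricted pair is maximal orthogonal in \<open>I\<close> and has second
    component \<open>B\<close>, which forces its first component to be \<open>A\<close>.\<close>
  have "U \<inter> Y1 = perp_left I r' (V \<inter> X2)"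
    using restrict_mem[OF L] unfolding mem_Pairs_iff by blast
  then have "U \<inter> Y1 = A" using V AB(4) by simp
  then show thesis using that L V by blast
qed

lemma restrict_order_iso:
  "order_iso (Pairs S r \<lparr>carrier := L\<rparr>) (Pairs I r') (\<lambda>(U, V). (U \<inter> Y1, V \<inter> X2))"
    (is "order_iso _ _ ?f")
proof -
  have "inj_on ?f L"
  proof (rule inj_onI, clarify)
    fix U V U' V' assume a: "(U, V) \<in> L" "(U', V') \<in> L" "U \<inter> Y1 = U' \<inter> Y1"
    have "U = U'" using restrict_le_iff[OF a(1,2)] restrict_le_iff[OF a(2,1)] a(3) by blast
    moreover have "V = V'" using snd_eq[OF a(1)] snd_eq[OF a(2)] a(3) by simp
    ultimately show "U = U' \<and> V = V'" ..
  qed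
  moreover have "?f ` L = carrier (Pairs I r')"
  proof
    show "?f ` L \<subseteq> carrier (Pairs I r')"
      using restrict_mem by auto
    show "carrier (Pairs I r') \<subseteq> ?f ` L"
    \<comment> \<open>A set of pairs of sets is formally a relation between sets, so
      \<open>subrelI\<close> exposes both components.\<close>
    proof (rule subrelI)
      fix A B assume "(A, B) \<in> carrier (Pairs I r')"
      then obtain U V where "(U, V) \<in> L" "U \<inter> Y1 = A" "V \<inter> X2 = B"
        by (rule restrict_surj)
      then show "(A, B) \<in> ?f ` L" by (force intro: rev_image_eqI)
    qed
  qed
  moreover have "order_emb (Pairs S r \<lparr>carrier := L\<rparr>) (Pairs I r') ?f"
    unfolding order_emb_def
  proof (intro conjI ballI)
    show "weak_partial_order (Pairs S r \<lparr>carrier := L\<rparr>)"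
      using partial_order.axioms(1)[OF partial_order_Pairs]
      by (rule weak_partial_order_subset) (auto simp: at_least_at_most_def)
    show "weak_partial_order (Pairs I r')"
      by (rule partial_order.axioms(1)[OF partial_order_Pairs])
    fix P Q
    assume "P \<in> carrier (Pairs S r \<lparr>carrier := L\<rparr>)" "Q \<in> carrier (Pairs S r \<lparr>carrier := L\<rparr>)"
    moreover obtain U V U' V' where "P = (U, V)" "Q = (U', V')" by fastforce
    ultimately show "?f P \<sqsubseteq>\<^bsub>Pairs I r'\<^esub> ?f Q \<longleftrightarrow> P \<sqsubseteq>\<^bsub>Pairs S r \<lparr>carrier := L\<rparr>\<^esub> Q"
      using restrict_le_iff[of U V U' V'] by (simp add: Pairs_def)
  qed
  ultimately show ?thesis unfolding order_iso_def bij_betw_def by simp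
qed

end

theorem theorem4p3:
  fixes S :: "'a set" and r e m r' e' m' :: "'a rel" and X1 Y1 X2 Y2 :: "'a set"
  assumes "two_acyclic_factorization_system S r e m"
    and "(X1, Y1) \<in> carrier (Pairs S r)"
    and "(X2, Y2) \<in> carrier (Pairs S r)"
    and "(X1, Y1) \<sqsubseteq>\<^bsub>Pairs S r\<^esub> (X2, Y2)"
    and "r' = Restr r (X2 \<inter> Y1)"
    and "(e', m') = Fact (X2 \<inter> Y1) r'"
  shows "two_acyclic_factorization_system (X2 \<inter> Y1) r' e' m' \<and>
    order_iso (Pairs S r \<lparr>carrier := \<lbrace>(X1, Y1)..(X2, Y2)\<rbrace>\<^bsub>Pairs S r\<^esub>\<rparr>)
      (Pairs (X2 \<inter> Y1) r')
      (\<lambda>(U, V). (U \<inter> Y1, V \<inter> X2))"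
proof -
  interpret two_acyclic_interval S r e m X1 Y1 X2 Y2
    using assms(1-4) by unfold_locales (auto simp: le_Pairs_iff)
  have "two_acyclic_factorization_system (X2 \<inter> Y1) r' e' m'"
    using two_acyclic_Restr[OF I_subset assms(5,6)] interval_factor by blast
  then show ?thesis using restrict_order_iso assms(5) by simp
qed

end
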